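(* $$\rho_1^2=1+\frac{2\pi}{3}+\sqrt{3}.$$
   Context: Let $\mathcal{C}$ be the unit circle in the Euclidean plane centered at the origin. For $n,k\in\mathbb{N}$, $k$ treasures are hidden at unknown points $\mathbf{T}=(T_1,\dots,T_k)\in\mathcal{C}^k$, and $n$ robots start at time $0$ at the origin. Each robot moves independently anywhere in the plane (not restricted to $\mathcal{C}$) with speed at most $1$. A treasure is discovered when the position of some robot coincides with it; upon discovery all robots instantly learn its location. A strategy specifies the motion of all $n$ robots, where at each time the motion may depend only on the information about treasures discovered so far; $\mathcal{S}_k^n$ is the set of all valid strategies for $n$ robots and $k$ treasures. For $S\in\mathcal{S}_k^n$ let $\rho_S(\mathbf{T})$ be the time required until every robot has individually visited (been at the location of) every treasure. Define $$\rho_k^n=\inf_{S\in\mathcal{S}_k^n}\ \sup_{\mathbf{T}\in\mathcal{C}^k}\rho_S(\mathbf{T}).$$ Thus $\rho_1^2$ is the case of $n=2$ robots and $k=1$ treasure. *)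

theory Defs
  imports "HOL-Analysis.Analysis"
begin

text \<open>
  The Euclidean plane is the type \<^typ>\<open>complex\<close>. Robots are numbered by \<open>i < n\<close> and treasures by
  \<open>j < k\<close>.
\<close>

definition treasure_configs :: "nat \<Rightarrow> (nat \<Rightarrow> complex) set" where
  "treasure_configs k = (\<Pi>\<^sub>E j\<in>{..<k}. sphere 0 1)"

text \<open>
  A strategy is represented by the motions it produces: \<open>S T i t\<close> is the position at time \<open>t\<close> of
  robot \<open>i\<close> when the treasures are located at \<open>T\<close>. That the robots do not know \<open>T\<close> in advance is
  the last condition in the definition of \<open>strategies\<close> below.
\<close>

type_synonym strategy = "(nat \<Rightarrow> complex) \<Rightarrow> nat \<Rightarrow> real \<Rightarrow> complex"

definition known_treasures ::
    "nat \<Rightarrow> nat \<Rightarrow> strategy \<Rightarrow> (nat \<Rightarrow> complex) \<Rightarrow> real \<Rightarrow> (nat \<rightharpoonup> complex)" where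
  "known_treasures n k S T t =
     (\<lambda>j. if j < k \<and> (\<exists>i<n. T j \<in> S T i ` {0..t}) then Some (T j) else None)"

text \<open>
  The last condition says that the positions at time \<open>t\<close> are a function of the evolution over
  \<open>{0..t}\<close> of the shared information, which includes the times of discovery. It is not circular:
  by continuity every discovered treasure has a first time of discovery, so for two
  configurations there is a first time \<open>t\<close> at which the information differs, if it ever does. The
  motions agree on \<open>{0..<t}\<close> by this condition, and at \<open>t\<close> by continuity, so they can separate only
  after an actual discovery has told the configurations apart.
\<close>

definition strategies :: "nat \<Rightarrow> nat \<Rightarrow> strategy set" where
  "strategies n k = {S.
     (\<forall>T\<in>treasure_configs k. \<forall>i<n. S T i 0 = 0 \<and> 1-lipschitz_on {0..} (S T i)) \<and>
     (\<forall>T\<in>treasure_configs k. \<forall>T'\<in>treasure_configs k. \<forall>t\<ge>0.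
        (\<forall>s\<in>{0..t}. known_treasures n k S T s = known_treasures n k S T' s) \<longrightarrow>
        (\<forall>i<n. S T i t = S T' i t))}"

text \<open>The value is \<open>\<infinity>\<close> if some robot never visits some treasure.\<close>

definition completion_time :: "nat \<Rightarrow> nat \<Rightarrow> strategy \<Rightarrow> (nat \<Rightarrow> complex) \<Rightarrow> ereal" where
  "completion_time n k S T =
     (INF t\<in>{t. 0 \<le> t \<and> (\<forall>i<n. \<forall>j<k. T j \<in> S T i ` {0..t})}. ereal t)"

definition optimal_time :: "nat \<Rightarrow> nat \<Rightarrow> ereal" where
  "optimal_time n k =
     (INF S\<in>strategies n k. SUP T\<in>treasure_configs k. completion_time n k S T)"

end

theory Submission
  imports Defs "HOL-Real_Asymp.Real_Asymp"
begin

text \<open>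
  Upper bound: both robots walk to \<open>1\<close> and then along the circle in opposite directions. A treasure
  at angle \<open>\<plusminus>x\<close> is found at time \<open>1 + x\<close>, when the other robot is \<open>2 sin x\<close> away, and
  \<open>1 + x + 2 sin x\<close> is maximal at \<open>x = 2\<pi>/3\<close>.

  Lower bound: take \<open>3M\<close> equally spaced points, grouped into \<open>M\<close> equilateral triangles, and a time
  \<open>t < 1 + 2\<pi>/3\<close>. If two vertices of one triangle are both unvisited at time \<open>t\<close>, hide the treasure
  at the one that is visited later: some robot is at the other one after time \<open>t\<close>, hence \<open>\<surd>3\<close> away from
  the still undiscovered treasure. Otherwise \<open>2M\<close> of the points are visited by time \<open>t\<close>, so \<open>M\<close> of
  them by one robot, which takes time at least \<open>1 + 2(M - 1) sin (\<pi>/3M)\<close>; this tends to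
  \<open>1 + 2\<pi>/3\<close>.
\<close>

section \<open>Chords\<close>

lemma dist_cis: "dist (cis a) (cis b) = 2 * \<bar>sin ((a - b) / 2)\<bar>"
proof -
  have "(dist (cis a) (cis b))\<^sup>2 = (cos a - cos b)\<^sup>2 + (sin a - sin b)\<^sup>2"
    by (simp add: dist_norm cmod_power2)
  also have "\<dots> = 2 - 2 * cos (a - b)"
    using sin_cos_squared_add[of a] sin_cos_squared_add[of b]
    by (simp add: cos_diff power2_eq_square algebra_simps)
  also have "cos (a - b) = 1 - 2 * (sin ((a - b) / 2))\<^sup>2"
    using cos_double_sin[of "(a - b) / 2"] by (simp del: right_diff_distrib_numeral)
  finally have "(dist (cis a) (cis b))\<^sup>2 = (2 * \<bar>sin ((a - b) / 2)\<bar>)\<^sup>2"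
    by (simp add: power_mult_distrib)
  then show ?thesis
    by (subst (asm) power2_eq_iff_nonneg) auto
qed

lemma dist_cis_le: "dist (cis a) (cis b) \<le> \<bar>a - b\<bar>"
  using abs_sin_x_le_abs_x[of "(a - b) / 2"] by (simp add: dist_cis)

lemma sin_ge_of_symmetric_interval:
  fixes a x :: real
  assumes "0 \<le> a" "a \<le> x" "x \<le> pi - a"
  shows "sin a \<le> sin x"
proof (cases "x \<le> pi / 2")
  case True
  then show ?thesis using assms by (intro sin_monotone_2pi_le) auto
next
  case False
  then have "sin a \<le> sin (pi - x)" using assms by (intro sin_monotone_2pi_le) auto
  then show ?thesis by simp
qed

text \<open>With truncated subtraction the hypotheses place |k - l| between \<open>m\<close> and
  \<open>n - m\<close>, so half the angle difference lies, up to sign, between pi m / n and pi - pi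
  m / n. It serves with \<open>m\<close> = 1 for any two distinct vertices and with \<open>n\<close>
  = 3 \<open>m\<close> for two vertices of one triangle.\<close>

lemma dist_cis_polygon_ge:
  fixes k l n m :: nat
  assumes "k < n" "l < n" "m \<le> k - l \<or> m \<le> l - k" "k - l \<le> n - m" "l - k \<le> n - m" "m \<le> n"
  shows "2 * sin (pi * m / n) \<le> dist (cis (2 * pi * k / n)) (cis (2 * pi * l / n))"
proof -
  have main: "2 * sin (pi * m / n) \<le> dist (cis (2 * pi * k / n)) (cis (2 * pi * l / n))"
    if "l \<le> k" "m \<le> k - l" "k - l \<le> n - m" "k < n" "m \<le> n" for k l :: nat
  proof -
    define d where "d = k - l"
    have "real d \<le> real n - real m"
      using that by (metis d_def of_nat_diff of_nat_le_iff)
    then have "pi * d / n \<le> pi * (real n - real m) / n"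
      by (intro divide_right_mono mult_left_mono) auto
    also have "\<dots> = pi - pi * m / n"
      using that by (simp add: field_simps)
    finally have "sin (pi * m / n) \<le> sin (pi * d / n)"
      using that by (intro sin_ge_of_symmetric_interval) (auto simp: d_def intro!: divide_right_mono)
    also have "pi * d / n = (2 * pi * k / n - 2 * pi * l / n) / 2"
      using that by (simp add: d_def field_simps of_nat_diff)
    finally show ?thesis unfolding dist_cis by linarith
  qed
  show ?thesis
  proof (cases "l \<le> k")
    case True
    then show ?thesis using assms main[of l k] by auto
  next
    case False
    then show ?thesis using assms main[of k l] by (auto simp: dist_commute)
  qed
qed

section \<open>The time needed to visit separated points\<close>

text \<open>Induction removing the maximum \<open>c\<close>: the remaining points lie in [a, c - d],
  which is why \<open>b\<close> has to vary.\<close>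

lemma separated_reals_span:
  fixes X :: "real set"
  assumes "finite X" "\<And>x y. x \<in> X \<Longrightarrow> y \<in> X \<Longrightarrow> x \<noteq> y \<Longrightarrow> d \<le> \<bar>x - y\<bar>"
    "\<And>x. x \<in> X \<Longrightarrow> a \<le> x \<and> x \<le> b" "X \<noteq> {}" "0 \<le> d"
  shows "a + (real (card X) - 1) * d \<le> b"
  using assms
proof (induction X arbitrary: b rule: finite_linorder_max_induct)
  case (insert c X)
  show ?case
  proof (cases "X = {}")
    case True
    then show ?thesis using insert.prems(2)[of c] by simp
  next
    case False
    have "x \<le> c - d" if "x \<in> X" for x
      using insert.prems(1)[of c x] insert.hyps that by fastforce
    then have "a + (real (card X) - 1) * d \<le> c - d"
      using insert.prems False by (intro insert.IH) auto
    moreover have "c \<notin> X" "c \<le> b" using insert by auto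
    ultimately show ?thesis using insert.hyps by (simp add: algebra_simps)
  qed
qed simp

text \<open>Pick one visiting time per point. Speed at most 1 makes these times
  \<open>d\<close>-separated, and none is below 1 because the circle is at distance 1 from the
  start.\<close>

lemma visiting_time_ge:
  fixes f :: "real \<Rightarrow> complex"
  assumes f: "1-lipschitz_on {0..} f" "f 0 = 0"
    and A: "finite A" "A \<noteq> {}" "A \<subseteq> sphere 0 1" "A \<subseteq> f ` {0..t}"
    and d: "0 \<le> d" "\<And>x y. x \<in> A \<Longrightarrow> y \<in> A \<Longrightarrow> x \<noteq> y \<Longrightarrow> d \<le> dist x y"
  shows "1 + (real (card A) - 1) * d \<le> t"
proof -
  have "\<forall>a\<in>A. \<exists>s. s \<in> {0..t} \<and> f s = a" using A(4) by blast
  then obtain s where s: "\<And>a. a \<in> A \<Longrightarrow> s a \<in> {0..t}" "\<And>a. a \<in> A \<Longrightarrow> f (s a) = a"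
    by metis
  have inj: "inj_on s A" by (metis s(2) inj_onI)
  have "1 + (real (card (s ` A)) - 1) * d \<le> t"
  proof (rule separated_reals_span)
    fix x y assume "x \<in> s ` A" "y \<in> s ` A" "x \<noteq> y"
    then obtain a b where ab: "a \<in> A" "b \<in> A" "x = s a" "y = s b" "a \<noteq> b" by auto
    have "d \<le> dist (f x) (f y)" using ab s d(2) by auto
    also have "\<dots> \<le> \<bar>x - y\<bar>"
      using lipschitz_onD[OF f(1), of x y] ab s(1) by (auto simp: dist_real_def)
    finally show "d \<le> \<bar>x - y\<bar>" .
  next
    fix x assume "x \<in> s ` A"
    then obtain a where a: "a \<in> A" "x = s a" by auto
    have "norm a = 1" using a A(3) by auto
    then have "1 \<le> x"
      using lipschitz_onD[OF f(1), of x 0] a s[of a] f(2) by (auto simp: dist_norm)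
    then show "1 \<le> x \<and> x \<le> t" using a s(1) by auto
  qed (use A d in auto)
  then show ?thesis by (simp add: card_image inj)
qed

section \<open>The lower bound\<close>

text \<open>The set of visiting times is closed, nonempty and bounded below, so it contains its
  infimum.\<close>

lemma first_time:
  fixes f :: "nat \<Rightarrow> real \<Rightarrow> complex"
  assumes "\<And>i. i < n \<Longrightarrow> 1-lipschitz_on {0..} (f i)" "i < n" "0 \<le> t" "f i t = z"
  shows "\<exists>s\<ge>0. (\<exists>i<n. f i s = z) \<and> (\<forall>u\<in>{0..<s}. \<forall>i<n. f i u \<noteq> z)"
proof -
  define X where "X = (\<Union>i<n. {s \<in> {0..}. f i s = z})"
  have "closed X" unfolding X_def
    using assms(1)
    by (intro closed_UN ballI continuous_closed_preimage_constant)
      (auto intro: lipschitz_on_continuous_on)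
  moreover have "X \<noteq> {}" using assms by (auto simp: X_def)
  moreover have bdd: "bdd_below X" by (rule bdd_belowI[of _ 0]) (auto simp: X_def)
  ultimately have "Inf X \<in> X" by (intro closed_contains_Inf)
  moreover have "u \<notin> X" if "u < Inf X" for u
    using cInf_lower[OF _ bdd, of u] that by auto
  ultimately show ?thesis by (intro exI[of _ "Inf X"]) (auto simp: X_def)
qed

text \<open>Carries the agreement of two motions over to the very moment of discovery, which
  \<open>nonanticipating\<close> does not cover.\<close>

lemma lipschitz_eq_at_endpoint:
  fixes f g :: "real \<Rightarrow> 'a::metric_space"
  assumes f: "1-lipschitz_on {0..} f" and g: "1-lipschitz_on {0..} g"
    and eq: "\<And>s. 0 \<le> s \<Longrightarrow> s < t \<Longrightarrow> f s = g s" and t: "0 < t"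
  shows "f t = g t"
proof (rule tendsto_unique)
  have cont: "(h \<longlongrightarrow> h t) (at t within {0..<t})" if "1-lipschitz_on {0..} h" for h :: "real \<Rightarrow> 'a"
    using lipschitz_on_continuous_on[OF that] t
    by (auto simp: continuous_on_def intro: tendsto_within_subset[of _ _ _ "{0..}"])
  show "(f \<longlongrightarrow> f t) (at t within {0..<t})" by (rule cont[OF f])
  show "(f \<longlongrightarrow> g t) (at t within {0..<t})"
    using cont[OF g] by (rule Lim_transform_eventually) (auto simp: eventually_at_filter eq)
  show "at t within {0..<t} \<noteq> bot"
    using t by (simp add: at_within_eq_bot_iff)
qed

text \<open>\<open>R z i\<close> is the motion of robot \<open>i\<close> when the single treasure is at \<open>z\<close>.\<close>

locale fast_search =
  fixes R :: "complex \<Rightarrow> nat \<Rightarrow> real \<Rightarrow> complex" and b :: real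
  assumes start: "norm z = 1 \<Longrightarrow> i < 2 \<Longrightarrow> R z i 0 = 0"
    and speed: "norm z = 1 \<Longrightarrow> i < 2 \<Longrightarrow> 1-lipschitz_on {0..} (R z i)"
    and nonanticipating:
      "\<lbrakk>norm z = 1; norm w = 1; 0 \<le> t; \<forall>s\<in>{0..t}. \<forall>i<2. R z i s \<noteq> z \<and> R w i s \<noteq> w; i < 2\<rbrakk>
        \<Longrightarrow> R z i t = R w i t"
    and complete: "norm z = 1 \<Longrightarrow> \<exists>t<b. 0 \<le> t \<and> (\<forall>i<2. z \<in> R z i ` {0..t})"
begin

definition found :: "complex \<Rightarrow> real" where
  "found z = (SOME s. 0 \<le> s \<and> (\<exists>i<2. R z i s = z) \<and> (\<forall>u\<in>{0..<s}. \<forall>i<2. R z i u \<noteq> z))"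

lemma found:
  assumes "norm z = 1"
  shows "0 \<le> found z" "\<exists>i<2. R z i (found z) = z"
    "\<And>u i. 0 \<le> u \<Longrightarrow> u < found z \<Longrightarrow> i < 2 \<Longrightarrow> R z i u \<noteq> z"
proof -
  obtain t where "0 \<le> t" "z \<in> R z 0 ` {0..t}" using complete[OF assms] by fastforce
  then obtain s where "0 \<le> s" "R z 0 s = z" by auto
  then have "\<exists>s. 0 \<le> s \<and> (\<exists>i<2. R z i s = z) \<and> (\<forall>u\<in>{0..<s}. \<forall>i<2. R z i u \<noteq> z)"
    by (intro first_time[where i = 0 and t = s]) (auto intro: speed assms)
  from someI_ex[OF this, folded found_def]
  show "0 \<le> found z" "\<exists>i<2. R z i (found z) = z"
    "\<And>u i. 0 \<le> u \<Longrightarrow> u < found z \<Longrightarrow> i < 2 \<Longrightarrow> R z i u \<noteq> z"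
    by auto
qed

text \<open>Before \<open>found z\<close> neither treasure has been discovered in its own scenario,
  so the robots cannot tell the two apart; continuity adds the endpoint.\<close>

lemma agree_until_found:
  assumes "norm z = 1" "norm w = 1" "found z \<le> found w" "i < 2"
  shows "R z i (found z) = R w i (found z)"
proof (cases "found z = 0")
  case True
  then show ?thesis using assms start by simp
next
  case False
  have "R z i s = R w i s" if "0 \<le> s" "s < found z" for s
    using assms that found(3)[of z] found(3)[of w] by (intro nonanticipating) auto
  then show ?thesis
    using assms False found(1)[of z]
    by - (rule lipschitz_eq_at_endpoint[OF speed speed], auto)
qed

text \<open>Hide the treasure at \<open>w\<close>. Up to \<open>found z\<close> the robots move as
  if it were at \<open>z\<close>, so one of them stands at \<open>z\<close> at that moment and still
  has to reach \<open>w\<close> before \<open>b\<close>.\<close>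

lemma found_plus_dist_less:
  assumes "norm z = 1" "norm w = 1" "found z \<le> found w"
  shows "found z + dist z w < b"
proof -
  obtain i where i: "i < 2" "R w i (found z) = z"
    using found(2)[of z] agree_until_found[of z w] assms by auto
  obtain t where t: "0 \<le> t" "t < b" "R w i t = w"
    using complete[of w] assms i(1) by fastforce
  \<comment> \<open>This puts the visit to \<open>w\<close> no earlier than \<open>found z\<close>,
    so the speed bound reads \<open>dist z w \<le> t - found z\<close>.\<close>
  have "found w \<le> t" using found(3)[of w t i] assms t i by force
  then have "dist z w \<le> t - found z"
    using lipschitz_onD[OF speed[OF assms(2) i(1)], of "found z" t] found(1)[OF assms(1)] assms t i
    by (auto simp: dist_real_def)
  then show ?thesis using t by simp
qed

text \<open>The discovery times belong to different scenarios. Placing the treasure at the point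
  \<open>w\<close> of \<open>A\<close> found last makes one scenario in which every point of
  \<open>A\<close> is visited by time \<open>t\<close>; the pigeonhole principle then splits
  \<open>A\<close> between the two robots.\<close>

lemma one_robot_visits_many:
  assumes A: "finite A" "A \<subseteq> sphere 0 1" "\<And>z. z \<in> A \<Longrightarrow> found z \<le> t" "0 < m" "2 * m \<le> card A"
  shows "\<exists>w i B. norm w = 1 \<and> i < 2 \<and> B \<subseteq> A \<and> m \<le> card B \<and> B \<subseteq> R w i ` {0..t}"
proof -
  have "A \<noteq> {}" using A by auto
  then obtain w where w: "w \<in> A" "\<And>z. z \<in> A \<Longrightarrow> found z \<le> found w"
    using A(1) Max_in[of "found ` A"] Max_ge[of "found ` A"] by fastforce
  define B where "B i = A \<inter> R w i ` {0..t}" for i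
  have "A \<subseteq> B 0 \<union> B 1"
  proof
    fix z assume z: "z \<in> A"
    have norm: "norm z = 1" "norm w = 1" using A(2) z w(1) by auto
    then obtain i where i: "i < 2" "R w i (found z) = z"
      using found(2)[of z] agree_until_found[of z w] w(2)[OF z] by auto
    have "found z \<in> {0..t}" using A(3)[OF z] found(1)[OF norm(1)] by auto
    then have "z \<in> B i" unfolding B_def using z i(2) by (metis IntI image_eqI)
    then show "z \<in> B 0 \<union> B 1" using i(1) by (auto simp: less_2_cases_iff)
  qed
  then have "card A \<le> card (B 0 \<union> B 1)" using A(1) by (intro card_mono) (auto simp: B_def)
  also have "\<dots> \<le> card (B 0) + card (B 1)" by (rule card_Un_le)
  finally have "m \<le> card (B 0) \<or> m \<le> card (B 1)" using A by linarith
  then obtain i where "i < 2" "m \<le> card (B i)" by (metis one_less_numeral_iff pos2 semiring_norm(76))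
  moreover have "norm w = 1" using w A by auto
  ultimately show ?thesis by (auto simp: B_def intro!: exI[of _ w] exI[of _ i] exI[of _ "B i"])
qed

lemma polygon_bound:
  fixes m :: nat
  assumes m: "0 < m"
  shows "1 + (real m - 1) * (2 * sin (pi / (3 * m))) \<le> b - sqrt 3"
proof -
  define p where "p k = cis (2 * pi * real k / real (3 * m))" for k :: nat
  define d where "d = 2 * sin (pi / (3 * m))"
  have norm_p [simp]: "norm (p k) = 1" for k by (simp add: p_def)
  have "pi / (3 * m) \<le> pi / 1" using m by (intro divide_left_mono) auto
  then have d0: "0 < d" unfolding d_def
    using m sin_gt_zero[of "pi / (3 * m)"] by (auto simp: field_simps)
  have sep: "d \<le> dist (p k) (p l)" if "k < 3 * m" "l < 3 * m" "k \<noteq> l" for k l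
  proof -
    have "1 \<le> k - l \<or> 1 \<le> l - k" "k - l \<le> 3 * m - 1" "l - k \<le> 3 * m - 1"
      using that by linarith+
    then show ?thesis
      using dist_cis_polygon_ge[of k "3 * m" l 1] that by (simp add: p_def d_def)
  qed
  have inj: "inj_on p {..<3 * m}"
  proof (rule inj_onI, rule ccontr)
    fix k l assume "k \<in> {..<3 * m}" "l \<in> {..<3 * m}" "p k = p l" "k \<noteq> l"
    then show False using sep[of k l] d0 by simp
  qed
  define D where "D = {k. k < 3 * m \<and> found (p k) \<le> b - sqrt 3}"
  \<comment> \<open>Residues mod \<open>m\<close> label the triangles. Two indices outside
    \<open>D\<close> with the same residue would give points at least sqrt 3 apart, both found after
    \<open>b - sqrt 3\<close>, against \<open>found_plus_dist_less\<close>. Hence \<open>D\<close>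
    misses at most \<open>m\<close> of the 3 \<open>m\<close> indices.\<close>
  have "inj_on (\<lambda>k. k mod m) ({..<3 * m} - D)"
  proof (rule inj_onI, rule ccontr)
    fix k l assume kl: "k \<in> {..<3 * m} - D" "l \<in> {..<3 * m} - D" "k mod m = l mod m" "k \<noteq> l"
    have far: "sqrt 3 \<le> dist (p k) (p l)"
    proof -
      have lem: "m \<le> k - l \<and> k - l \<le> 2 * m" if "l < k" "k mod m = l mod m" "k < 3 * m" for k l :: nat
      proof -
        have "m dvd k - l" using that by (simp add: mod_eq_dvd_iff_nat)
        then obtain q where q: "k - l = m * q" by auto
        have "m * q < m * 3" "0 < m * q" using q that by linarith+
        then have "q = 1 \<or> q = 2" by auto
        then show ?thesis using q by auto
      qed
      have "2 * sin (pi * m / (3 * m)) \<le> dist (p k) (p l)"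
        using dist_cis_polygon_ge[of k "3 * m" l m] lem[of k l] lem[of l k] kl
        by (cases "k < l") (auto simp: p_def)
      then show ?thesis using m by (simp add: sin_60)
    qed
    have "found (p k) > b - sqrt 3" "found (p l) > b - sqrt 3" using kl by (auto simp: D_def)
    then show False
      using found_plus_dist_less[of "p k" "p l"] found_plus_dist_less[of "p l" "p k"] far
      by (simp add: dist_commute) linarith
  qed
  then have "card ({..<3 * m} - D) \<le> card {..<m}"
    using m by (intro card_inj_on_le) auto
  moreover have "D \<subseteq> {..<3 * m}" by (auto simp: D_def)
  ultimately have "2 * m \<le> card D" by (simp add: card_Diff_subset finite_subset)
  then have card: "2 * m \<le> card (p ` D)"
    using inj \<open>D \<subseteq> _\<close> by (simp add: card_image inj_on_subset)
  obtain w i B where B: "norm w = 1" "i < 2" "B \<subseteq> p ` D" "m \<le> card B"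
      "B \<subseteq> R w i ` {0..b - sqrt 3}"
  proof -
    have "finite (p ` D)" "p ` D \<subseteq> sphere 0 1" "\<And>z. z \<in> p ` D \<Longrightarrow> found z \<le> b - sqrt 3"
      by (auto simp: D_def)
    from one_robot_visits_many[OF this m card] that show thesis by blast
  qed
  have "1 + (real (card B) - 1) * d \<le> b - sqrt 3"
  proof (rule visiting_time_ge[OF speed start])
    show "finite B" using B \<open>D \<subseteq> _\<close> by (meson finite_imageI finite_lessThan finite_subset)
    show "B \<noteq> {}" using B m by auto
    fix x y assume xy: "x \<in> B" "y \<in> B" "x \<noteq> y"
    then obtain k l where kl: "x = p k" "y = p l" "k \<in> D" "l \<in> D"
      using B(3) by blast
    then show "d \<le> dist x y" using xy by (auto simp: D_def intro!: sep)
  qed (use B d0 in auto)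
  moreover have "(real m - 1) * d \<le> (real (card B) - 1) * d"
    using B d0 by (intro mult_right_mono) auto
  ultimately show ?thesis by (simp add: d_def)
qed

lemma search_time_ge: "1 + 2 * pi / 3 + sqrt 3 \<le> b"
proof -
  have "((\<lambda>m::nat. 1 + (real m - 1) * (2 * sin (pi / (3 * m)))) \<longlongrightarrow> 1 + 2 * pi / 3) sequentially"
    by real_asymp
  then have "1 + 2 * pi / 3 \<le> b - sqrt 3"
  proof (rule tendsto_upperbound)
    show "\<forall>\<^sub>F m in sequentially. 1 + (real m - 1) * (2 * sin (pi / (3 * m))) \<le> b - sqrt 3"
      using eventually_gt_at_top[of 0] by eventually_elim (use polygon_bound in simp)
  qed simp
  then show ?thesis by simp
qed

end

section \<open>Transfer of the lower bound to strategies\<close>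

lemma treasure_configs_one: "(\<lambda>j\<in>{..<1}. z) \<in> treasure_configs 1 \<longleftrightarrow> norm z = 1"
  by (auto simp: treasure_configs_def)

text \<open>A strategy with a smaller worst case finishes every configuration before some real
  \<open>b\<close> still below the bound. Its motions then form an instance of
  \<open>fast_search\<close>, contradicting \<open>search_time_ge\<close>.\<close>

lemma optimal_time_ge: "ereal (1 + 2 * pi / 3 + sqrt 3) \<le> optimal_time 2 1"
  unfolding optimal_time_def
proof (rule INF_greatest, rule ccontr)
  fix S assume S: "S \<in> strategies 2 1"
  assume "\<not> ereal (1 + 2 * pi / 3 + sqrt 3) \<le> (SUP T\<in>treasure_configs 1. completion_time 2 1 S T)"
  then obtain b where b: "(SUP T\<in>treasure_configs 1. completion_time 2 1 S T) < ereal b"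
      "b < 1 + 2 * pi / 3 + sqrt 3"
    using ereal_dense2[of "SUP T\<in>treasure_configs 1. completion_time 2 1 S T"
        "ereal (1 + 2 * pi / 3 + sqrt 3)"]
    by (auto simp: not_le)
  \<comment> \<open>The restriction makes \<open>c z\<close> extensional, as membership in a
    \<open>PiE\<close> set demands.\<close>
  define c where "c z = (\<lambda>j\<in>{..<1::nat}. z)" for z :: complex
  have c: "c z \<in> treasure_configs 1" "c z 0 = z" if "norm z = 1" for z
    using that treasure_configs_one by (auto simp: c_def)
  have motion: "S T i 0 = 0" "1-lipschitz_on {0..} (S T i)"
    if "T \<in> treasure_configs 1" "i < 2" for T i
    using S that unfolding strategies_def mem_Collect_eq by blast+
  have same_motion: "S T i t = S T' i t"
    if "T \<in> treasure_configs 1" "T' \<in> treasure_configs 1" "0 \<le> t"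
      "\<forall>s\<in>{0..t}. known_treasures 2 1 S T s = known_treasures 2 1 S T' s" "i < 2"
    for T T' t i
    using S that unfolding strategies_def mem_Collect_eq by metis
  interpret fast_search "\<lambda>z. S (c z)" b
  proof
    fix z :: complex assume z: "norm z = 1"
    have "completion_time 2 1 S (c z) < ereal b"
      using SUP_upper[OF c(1)[OF z], of "completion_time 2 1 S"] b(1) by (rule le_less_trans)
    then show "\<exists>t<b. 0 \<le> t \<and> (\<forall>i<2. z \<in> S (c z) i ` {0..t})"
      using c[OF z] by (auto simp: completion_time_def INF_less_iff)
  next
    fix z w :: complex and t :: real and i :: nat
    assume zw: "norm z = 1" "norm w = 1" "0 \<le> t" "i < 2"
      and no: "\<forall>s\<in>{0..t}. \<forall>i<2. S (c z) i s \<noteq> z \<and> S (c w) i s \<noteq> w"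
    \<comment> \<open>Up to time \<open>t\<close> nothing is discovered in either scenario, so both
      knowledge maps are empty.\<close>
    have "known_treasures 2 1 S (c z) s = known_treasures 2 1 S (c w) s" if "s \<in> {0..t}" for s
    proof -
      have "T 0 \<notin> S T i ` {0..s}" if "i < 2" "\<forall>u\<in>{0..t}. \<forall>i<2. S T i u \<noteq> T 0" for T i
        using that \<open>s \<in> {0..t}\<close> by force
      then have "known_treasures 2 1 S T s = Map.empty"
        if "\<forall>u\<in>{0..t}. \<forall>i<2. S T i u \<noteq> T 0" for T
        using that by (intro ext) (auto simp: known_treasures_def)
      then show ?thesis using no c(2)[OF zw(1)] c(2)[OF zw(2)] by simp
    qed
    then show "S (c z) i t = S (c w) i t"
      using same_motion[OF c(1)[OF zw(1)] c(1)[OF zw(2)] zw(3) _ zw(4)] by blast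
  qed (use motion c(1) in blast)+
  show False using search_time_ge b(2) by simp
qed

section \<open>The upper bound\<close>

text \<open>The derivative 1 + 2 cos changes sign from plus to minus at 2 pi / 3, the maximum on
  [0, pi].\<close>

lemma add_two_sin_le:
  fixes x :: real
  assumes "0 \<le> x" "x \<le> pi"
  shows "x + 2 * sin x \<le> 2 * pi / 3 + sqrt 3"
proof -
  let ?f = "\<lambda>x::real. x + 2 * sin x"
  have der: "(?f has_real_derivative 1 + 2 * cos y) (at y)" for y
    by (auto intro!: derivative_eq_intros)
  have top: "?f (2 * pi / 3) = 2 * pi / 3 + sqrt 3"
    using sin_120 by simp
  show ?thesis
  proof (cases "x \<le> 2 * pi / 3")
    case True
    have "0 \<le> 1 + 2 * cos y" if "x \<le> y" "y \<le> 2 * pi / 3" for y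
      using cos_monotone_0_pi_le[of y "2 * pi / 3"] cos_120 that assms by auto
    then have "?f x \<le> ?f (2 * pi / 3)"
      using der by (intro DERIV_nonneg_imp_nondecreasing[OF True]) blast
    then show ?thesis using top by simp
  next
    case False
    have "1 + 2 * cos y \<le> 0" if "2 * pi / 3 \<le> y" "y \<le> x" for y
      using cos_monotone_0_pi_le[of "2 * pi / 3" y] cos_120 that assms by auto
    then have "?f x \<le> ?f (2 * pi / 3)"
      using der False by (intro DERIV_nonpos_imp_nonincreasing[of "2 * pi / 3" x]) (linarith, blast)
    then show ?thesis using top by simp
  qed
qed

text \<open>Polar form covering both phases at once: the modulus grows up to time 1, afterwards only
  the angle changes.\<close>

definition sweep :: "nat \<Rightarrow> real \<Rightarrow> complex" where
  "sweep i t = of_real (min t 1) * cis ((if i = 0 then 1 else -1) * max 0 (t - 1))"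

text \<open>
  After the discovery at time \<open>1 + \<bar>Arg z\<bar>\<close> each robot walks to the treasure \<open>z\<close> at the constant speed
  (at most \<open>1\<close>) that brings it there exactly at the optimal time. This makes the motion affine, without
  a special case for the robot that is already at \<open>z\<close>.
\<close>

definition sweep_strategy :: strategy where
  "sweep_strategy T i t =
     (let z = T 0; s = 1 + \<bar>Arg z\<bar>; b = 1 + 2 * pi / 3 + sqrt 3
      in sweep i (min t s) + of_real ((max s (min t b) - s) / (b - s)) * (z - sweep i s))"

text \<open>Split the displacement into a radial and an angular part. Their bounds add up to |t -
  u|, since \<open>t\<close> is the sum of \<open>min t 1\<close> and \<open>max 0 (t - 1)\<close>,
  both monotone in \<open>t\<close>.\<close>

lemma sweep_lipschitz: "dist (sweep i t) (sweep i u) \<le> \<bar>t - u\<bar>" if "0 \<le> t" "0 \<le> u"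
proof -
  define e :: real where "e = (if i = 0 then 1 else -1)"
  have e: "\<bar>e\<bar> = 1" by (simp add: e_def)
  define v w where "v = cis (e * max 0 (t - 1))" and "w = cis (e * max 0 (u - 1))"
  have "dist v w \<le> \<bar>e * max 0 (t - 1) - e * max 0 (u - 1)\<bar>"
    unfolding v_def w_def by (rule dist_cis_le)
  also have "\<dots> = \<bar>max 0 (t - 1) - max 0 (u - 1)\<bar>"
    using e by (simp flip: right_diff_distrib add: abs_mult)
  finally have vw: "norm (v - w) \<le> \<bar>max 0 (t - 1) - max 0 (u - 1)\<bar>" by (simp add: dist_norm)
  have "sweep i t - sweep i u = of_real (min t 1 - min u 1) * v + of_real (min u 1) * (v - w)"
    by (simp add: sweep_def v_def w_def e_def algebra_simps)
  then have "dist (sweep i t) (sweep i u)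
      \<le> norm (of_real (min t 1 - min u 1) * v) + norm (of_real (min u 1) * (v - w))"
    by (simp add: dist_norm norm_triangle_ineq)
  also have "\<dots> = \<bar>min t 1 - min u 1\<bar> + \<bar>min u 1\<bar> * norm (v - w)"
    by (simp only: norm_mult norm_of_real) (simp add: v_def)
  also have "\<bar>min u 1\<bar> * norm (v - w) \<le> 1 * norm (v - w)"
    using that by (intro mult_right_mono) auto
  finally show ?thesis using vw by (auto simp: min_def max_def split: if_splits)
qed

lemma sweep_finds:
  assumes "norm z = 1"
  shows "\<exists>i<2. sweep i (1 + \<bar>Arg z\<bar>) = z"
proof -
  have z: "cis (Arg z) = z" using assms cis_Arg[of z] by (force simp: sgn_eq)
  have "sweep (if 0 \<le> Arg z then 0 else 1) (1 + \<bar>Arg z\<bar>) = z"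
    by (simp add: sweep_def z)
  then show ?thesis by (intro exI[of _ "if 0 \<le> Arg z then 0 else 1"]) simp
qed

text \<open>At this time a robot is either at \<open>z\<close> or at its mirror image in the real
  axis, and the chord between these has length 2 sin |Arg z|.\<close>

lemma sweep_dist_treasure:
  assumes "norm z = 1"
  shows "dist z (sweep i (1 + \<bar>Arg z\<bar>)) \<le> 2 * sin \<bar>Arg z\<bar>"
proof -
  have z: "cis (Arg z) = z" using assms cis_Arg[of z] by (force simp: sgn_eq)
  have "0 \<le> sin \<bar>Arg z\<bar>" using Arg_bounded[of z] by (intro sin_ge_zero) auto
  then have "dist (cis (Arg z)) (sweep i (1 + \<bar>Arg z\<bar>)) \<le> 2 * sin \<bar>Arg z\<bar>"
    by (auto simp: sweep_def dist_cis abs_if)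
  then show ?thesis using z by simp
qed

lemma treasure_configs_norm: "T \<in> treasure_configs 1 \<Longrightarrow> norm (T 0) = 1"
  using PiE_mem[of T "{..<1}" "\<lambda>_. sphere 0 1" 0] by (simp add: treasure_configs_def)

text \<open>It amounts to pi / 3 < 4 / 3 < sqrt 3. Strictness keeps the divisor \<open>b - s\<close>
  of \<open>sweep_strategy\<close> positive.\<close>

lemma discovery_before_end: "1 + \<bar>Arg z\<bar> < 1 + 2 * pi / 3 + sqrt 3"
proof -
  have "3 / 2 < sqrt (3::real)" by (rule real_less_rsqrt) (simp add: power2_eq_square)
  moreover have "\<bar>Arg z\<bar> \<le> pi" using Arg_bounded[of z] by linarith
  ultimately show ?thesis using pi_less_4 by linarith
qed

text \<open>The sweep runs on the clock \<open>min t s\<close> and the final walk on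
  \<open>max s (min t b)\<close>; together these clocks advance by at most |t - u|. The walk has
  speed at most 1 because its length is at most 2 sin |Arg z|, which \<open>add_two_sin_le\<close>
  bounds by \<open>b - s\<close>.\<close>

lemma sweep_strategy_speed:
  assumes "norm (T 0) = 1"
  shows "1-lipschitz_on {0..} (sweep_strategy T i)"
proof (rule lipschitz_onI)
  fix t u :: real assume tu: "t \<in> {0..}" "u \<in> {0..}"
  define z s b where "z = T 0" and "s = 1 + \<bar>Arg z\<bar>" and "b = 1 + 2 * pi / 3 + sqrt 3"
  define x y where "x = max s (min t b)" and "y = max s (min u b)"
  have sb: "s < b" unfolding s_def b_def by (rule discovery_before_end)
  have "dist z (sweep i s) \<le> 2 * sin \<bar>Arg z\<bar>"
    unfolding s_def by (rule sweep_dist_treasure) (simp add: z_def assms)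
  also have "\<dots> \<le> b - s"
    using add_two_sin_le[of "\<bar>Arg z\<bar>"] Arg_bounded[of z] by (simp add: s_def b_def abs_le_iff)
  finally have speed: "norm (z - sweep i s) \<le> b - s" by (simp add: dist_norm)
  have motion: "sweep_strategy T i v = sweep i (min v s)
      + of_real ((max s (min v b) - s) / (b - s)) * (z - sweep i s)" for v
    by (simp only: sweep_strategy_def Let_def z_def s_def b_def)
  have "(x - y) / (b - s) = (x - s) / (b - s) - (y - s) / (b - s)"
    by (simp add: diff_divide_distrib)
  then have "sweep_strategy T i t - sweep_strategy T i u
      = (sweep i (min t s) - sweep i (min u s)) + of_real ((x - y) / (b - s)) * (z - sweep i s)"
    by (simp only: motion x_def y_def of_real_diff left_diff_distrib) simp
  then have "dist (sweep_strategy T i t) (sweep_strategy T i u)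
      \<le> dist (sweep i (min t s)) (sweep i (min u s)) + \<bar>x - y\<bar> / (b - s) * norm (z - sweep i s)"
    using sb norm_triangle_ineq[of "sweep i (min t s) - sweep i (min u s)"
        "of_real ((x - y) / (b - s)) * (z - sweep i s)"]
    by (simp only: dist_norm norm_mult norm_of_real abs_divide) simp
  also have "\<bar>x - y\<bar> / (b - s) * norm (z - sweep i s) \<le> \<bar>x - y\<bar> / (b - s) * (b - s)"
    using speed sb by (intro mult_left_mono) auto
  also have "\<dots> = \<bar>x - y\<bar>" using sb by simp
  also have "dist (sweep i (min t s)) (sweep i (min u s)) \<le> \<bar>min t s - min u s\<bar>"
    using tu by (intro sweep_lipschitz) (auto simp: s_def)
  finally show "dist (sweep_strategy T i t) (sweep_strategy T i u) \<le> 1 * dist t u"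
    using sb by (auto simp: dist_real_def x_def y_def min_def max_def split: if_splits)
qed simp

lemma sweep_strategy_before:
  "t \<le> 1 + \<bar>Arg (T 0)\<bar> \<Longrightarrow> sweep_strategy T i t = sweep i t"
  using discovery_before_end[of "T 0"] by (simp add: sweep_strategy_def Let_def)

lemma sweep_strategy_known:
  assumes "norm (T 0) = 1"
  shows "known_treasures 2 1 sweep_strategy T (1 + \<bar>Arg (T 0)\<bar>) 0 = Some (T 0)"
proof -
  obtain i where i: "i < 2" "sweep i (1 + \<bar>Arg (T 0)\<bar>) = T 0"
    using sweep_finds[OF assms] by auto
  have "T 0 \<in> sweep_strategy T i ` {0..1 + \<bar>Arg (T 0)\<bar>}"
    by (rule image_eqI[of _ _ "1 + \<bar>Arg (T 0)\<bar>"]) (auto simp: i(2) sweep_strategy_before)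
  then show ?thesis using i(1) by (auto simp: known_treasures_def)
qed

text \<open>Until both discovery times the motion is \<open>sweep\<close>, whatever the treasure.
  Once \<open>t\<close> exceeds one of them, that treasure is known, so equal knowledge forces
  \<open>T 0 = T' 0\<close>, and the motion depends on \<open>T\<close> only through
  \<open>T 0\<close>.\<close>

lemma sweep_strategy_nonanticipating:
  assumes T: "norm (T 0) = 1" and T': "norm (T' 0) = 1"
    and known: "\<forall>s\<in>{0..t}. known_treasures 2 1 sweep_strategy T s = known_treasures 2 1 sweep_strategy T' s"
  shows "sweep_strategy T i t = sweep_strategy T' i t"
proof (cases "t \<le> 1 + \<bar>Arg (T 0)\<bar> \<and> t \<le> 1 + \<bar>Arg (T' 0)\<bar>")
  case True
  then show ?thesis by (simp add: sweep_strategy_before)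
next
  case False
  have known_SomeD: "known_treasures 2 1 sweep_strategy V s 0 = Some z \<Longrightarrow> z = V 0" for V s z
    by (auto simp: known_treasures_def split: if_splits)
  have "T 0 = T' 0"
  proof (cases "t \<le> 1 + \<bar>Arg (T 0)\<bar>")
    case True
    then have "1 + \<bar>Arg (T' 0)\<bar> \<in> {0..t}" using False by auto
    then have "known_treasures 2 1 sweep_strategy T (1 + \<bar>Arg (T' 0)\<bar>) 0 = Some (T' 0)"
      using known sweep_strategy_known[of T', OF T'] by simp
    then show ?thesis using known_SomeD by metis
  next
    case False
    then have "1 + \<bar>Arg (T 0)\<bar> \<in> {0..t}" by auto
    then have "known_treasures 2 1 sweep_strategy T' (1 + \<bar>Arg (T 0)\<bar>) 0 = Some (T 0)"
      using known sweep_strategy_known[of T, OF T] by simp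
    then show ?thesis using known_SomeD by metis
  qed
  then show ?thesis by (simp add: sweep_strategy_def)
qed

lemma sweep_strategy_valid: "sweep_strategy \<in> strategies 2 1"
  unfolding strategies_def mem_Collect_eq
proof (intro conjI ballI allI impI)
  fix T :: "nat \<Rightarrow> complex" and i :: nat
  show "sweep_strategy T i 0 = 0" by (simp add: sweep_strategy_before sweep_def)
next
  fix T :: "nat \<Rightarrow> complex" and i :: nat
  assume "T \<in> treasure_configs 1"
  then show "1-lipschitz_on {0..} (sweep_strategy T i)"
    by (intro sweep_strategy_speed treasure_configs_norm)
next
  fix T T' :: "nat \<Rightarrow> complex" and t :: real and i :: nat
  assume "T \<in> treasure_configs 1" "T' \<in> treasure_configs 1"
    "\<forall>s\<in>{0..t}. known_treasures 2 1 sweep_strategy T s = known_treasures 2 1 sweep_strategy T' s"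
  then show "sweep_strategy T i t = sweep_strategy T' i t"
    by (intro sweep_strategy_nonanticipating treasure_configs_norm)
qed

lemma sweep_strategy_completion:
  assumes "norm (T 0) = 1"
  shows "completion_time 2 1 sweep_strategy T \<le> ereal (1 + 2 * pi / 3 + sqrt 3)"
proof -
  define b where "b = 1 + 2 * pi / 3 + sqrt 3"
  define s where "s = 1 + \<bar>Arg (T 0)\<bar>"
  have "s < b" unfolding s_def b_def by (rule discovery_before_end)
  \<comment> \<open>At time \<open>b\<close> the walked fraction is 1, which puts every robot at the
    treasure.\<close>
  then have arrived: "(max s (min b b) - s) / (b - s) = 1" by simp
  have "sweep_strategy T i b = T 0" for i
  proof -
    have "sweep_strategy T i b
        = sweep i (min b s) + of_real ((max s (min b b) - s) / (b - s)) * (T 0 - sweep i s)"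
      by (simp only: sweep_strategy_def Let_def s_def b_def)
    then show ?thesis unfolding arrived using \<open>s < b\<close> by simp
  qed
  moreover have "0 \<le> b" by (simp add: b_def)
  ultimately have "completion_time 2 1 sweep_strategy T \<le> ereal b"
    unfolding completion_time_def by (intro INF_lower) (auto intro!: image_eqI[of _ _ b])
  then show ?thesis by (simp add: b_def)
qed

theorem theorem18:
  "optimal_time 2 1 = ereal (1 + 2 * pi / 3 + sqrt 3)"
proof (rule antisym)
  have "(SUP T\<in>treasure_configs 1. completion_time 2 1 sweep_strategy T)
      \<le> ereal (1 + 2 * pi / 3 + sqrt 3)"
    by (intro SUP_least sweep_strategy_completion treasure_configs_norm)
  then show "optimal_time 2 1 \<le> ereal (1 + 2 * pi / 3 + sqrt 3)"
    unfolding optimal_time_def by (rule INF_lower2[OF sweep_strategy_valid])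
qed (rule optimal_time_ge)

end
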